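(* Let $k$ be a positive integer and let $\mathbb{F}_q$ be the finite field with $q$ elements. If $q>k^4$, then every element of $\mathbb{F}_q$ can be written as a sum of two $k$-th powers of elements of $\mathbb{F}_q$.
   Context: The element $0=0^k$ counts as a $k$-th power. *)

theory Defs
  imports Complex_Main "HOL-Library.Cardinality"
begin

end

theory Submission
  imports Defs "HOL-Computational_Algebra.Polynomial" "HOL-Analysis.Convex"
begin

text \<open>Let \<open>A\<close> be the set of nonzero \<open>k\<close>-th powers, \<open>m\<close> its size and \<open>c \<noteq> 0\<close>. For \<open>u \<noteq> 0\<close> let
  \<open>r u y\<close> count the representations \<open>y = u * z - w\<close> with \<open>z \<in> c * A\<close> and \<open>w \<in> A\<close>.
  Two distinct points with different first and second coordinates lie on exactly one line of
  slope \<open>u \<noteq> 0\<close>, which gives the second moment of \<open>r\<close> exactly. If \<open>c\<close> were not a sum of two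
  elements of \<open>A\<close>, then for every \<open>u \<in> A\<close> the function \<open>r u\<close> would vanish on \<open>A\<close>, and
  Cauchy-Schwarz on the complement of \<open>A\<close> would force \<open>m ^ 4 \<le> (q - m) ^ 3\<close>. But
  \<open>q - 1 \<le> k * m\<close>, so that \<open>q > k ^ 4\<close> yields \<open>m \<ge> k ^ 3\<close> and hence
  \<open>(q - m) ^ 3 < (k * m) ^ 3 \<le> m ^ 4\<close> for \<open>k \<ge> 2\<close>.\<close>

definition rep :: "'a::field set \<Rightarrow> 'a set \<Rightarrow> 'a \<Rightarrow> 'a \<Rightarrow> real" where
  "rep Z W u y = (\<Sum>z\<in>Z. \<Sum>w\<in>W. of_bool (u * z - w = y))"

lemma sum_rep:
  fixes Z W :: "'a::{field,finite} set"
  shows "(\<Sum>y\<in>UNIV. rep Z W u y) = real (card Z) * real (card W)"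
proof -
  have "(\<Sum>y\<in>UNIV. rep Z W u y) = (\<Sum>z\<in>Z. \<Sum>y\<in>UNIV. \<Sum>w\<in>W. of_bool (u * z - w = y))"
    unfolding rep_def by (rule sum.swap)
  also have "\<dots> = (\<Sum>z\<in>Z. \<Sum>w\<in>W. \<Sum>y\<in>UNIV. of_bool (u * z - w = y))"
    by (intro sum.cong refl sum.swap)
  also have "\<dots> = (\<Sum>z\<in>Z. \<Sum>w\<in>W. 1)"
    by (intro sum.cong refl) (simp add: of_bool_def)
  finally show ?thesis by simp
qed

lemma sum_rep_square:
  fixes Z W :: "'a::{field,finite} set"
  shows "(\<Sum>y\<in>UNIV. (rep Z W u y)\<^sup>2)
    = (\<Sum>z\<in>Z. \<Sum>w\<in>W. \<Sum>z'\<in>Z. \<Sum>w'\<in>W. of_bool (u * z - w = u * z' - w'))"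
proof -
  have "(\<Sum>y\<in>UNIV. (rep Z W u y)\<^sup>2) =
     (\<Sum>y\<in>UNIV. \<Sum>z\<in>Z. \<Sum>w\<in>W. of_bool (u * z - w = y) * rep Z W u y)"
    by (simp add: power2_eq_square rep_def sum_distrib_right)
  also have "\<dots> = (\<Sum>z\<in>Z. \<Sum>y\<in>UNIV. \<Sum>w\<in>W. of_bool (u * z - w = y) * rep Z W u y)"
    by (rule sum.swap)
  also have "\<dots> = (\<Sum>z\<in>Z. \<Sum>w\<in>W. \<Sum>y\<in>UNIV. of_bool (u * z - w = y) * rep Z W u y)"
    by (intro sum.cong refl sum.swap)
  also have "\<dots> = (\<Sum>z\<in>Z. \<Sum>w\<in>W. rep Z W u (u * z - w))"
    by (intro sum.cong refl) (simp add: of_bool_def if_distrib[of "\<lambda>x. x * _"] cong: if_cong)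
  finally show ?thesis
    by (simp add: rep_def eq_commute)
qed

text \<open>If \<open>z = z'\<close>, the equation says \<open>w = w'\<close> for every slope.
  Otherwise its only solution is \<open>u = (w - w') / (z - z')\<close>, which is nonzero exactly
  when \<open>w \<noteq> w'\<close>.\<close>

lemma card_slopes:
  fixes z w z' w' :: "'a::{field,finite}"
  shows "(\<Sum>u\<in>UNIV - {0}. of_bool (u * z - w = u * z' - w'))
    = (real CARD('a) - 1) * of_bool (z = z') * of_bool (w = w')
      + (1 - of_bool (z = z')) * (1 - of_bool (w = w'))"
proof (cases "z = z'")
  case True
  have "real (card (UNIV - {0::'a})) = real CARD('a) - 1"
    using zero_less_card_finite[where 'a='a] by (simp add: card_Diff_singleton of_nat_diff)
  then show ?thesis using True by auto
next
  case False
  have "(u * z - w = u * z' - w') \<longleftrightarrow> u = (w - w') / (z - z')" for u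
    using False by (auto simp: field_simps)
  then show ?thesis using False
    by (simp add: of_bool_def)
qed

lemma sum_offdiag:
  assumes "finite Z"
  shows "(\<Sum>z\<in>Z. \<Sum>z'\<in>Z. 1 - of_bool (z = z')) = real (card Z) ^ 2 - real (card Z)"
    and "(\<Sum>z\<in>Z. \<Sum>z'\<in>Z. of_bool (z = z')) = real (card Z)"
  using assms by (simp_all add: of_bool_def sum_subtractf power2_eq_square algebra_simps)

lemma second_moment_rep:
  fixes Z W :: "'a::{field,finite} set"
  shows "(\<Sum>u\<in>UNIV - {0}. \<Sum>y\<in>UNIV. (rep Z W u y)\<^sup>2)
    = (real CARD('a) - 1) * real (card Z) * real (card W)
      + (real (card Z) ^ 2 - real (card Z)) * (real (card W) ^ 2 - real (card W))"
proof -
  have "(\<Sum>u\<in>UNIV - {0}. \<Sum>y\<in>UNIV. (rep Z W u y)\<^sup>2)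
    = (\<Sum>z\<in>Z. \<Sum>w\<in>W. \<Sum>z'\<in>Z. \<Sum>w'\<in>W. \<Sum>u\<in>UNIV - {0}. of_bool (u * z - w = u * z' - w'))"
    by (simp only: sum_rep_square sum.swap[where A = "UNIV - {0}"])
  \<comment> \<open>With the pairs \<open>(z, z')\<close> and \<open>(w, w')\<close> grouped, each
    term factors into a sum over \<open>Z\<close> times a sum over \<open>W\<close>.\<close>
  also have "\<dots> = (\<Sum>z\<in>Z. \<Sum>z'\<in>Z. \<Sum>w\<in>W. \<Sum>w'\<in>W.
      (real CARD('a) - 1) * of_bool (z = z') * of_bool (w = w')
      + (1 - of_bool (z = z')) * (1 - of_bool (w = w')))"
    unfolding card_slopes by (intro sum.cong refl sum.swap)
  also have "\<dots> = (real CARD('a) - 1) * (\<Sum>z\<in>Z. \<Sum>z'\<in>Z. of_bool (z = z')) * (\<Sum>w\<in>W. \<Sum>w'\<in>W. of_bool (w = w'))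
     + (\<Sum>z\<in>Z. \<Sum>z'\<in>Z. 1 - of_bool (z = z')) * (\<Sum>w\<in>W. \<Sum>w'\<in>W. 1 - of_bool (w = w'))"
    by (simp only: sum.distrib sum_distrib_left[symmetric] sum_distrib_right[symmetric] mult.assoc)
  finally show ?thesis
    by (simp only: sum_offdiag[OF finite])
qed

text \<open>Cauchy-Schwarz on \<open>S\<close>, which carries the whole mass of
  \<open>rep Z W u\<close>. For empty \<open>S\<close> the quotient is \<open>0\<close>, as division
  by zero gives \<open>0\<close>.\<close>

lemma second_moment_rep_ge:
  fixes Z W S :: "'a::{field,finite} set"
  assumes "\<And>y. y \<notin> S \<Longrightarrow> rep Z W u y = 0"
  shows "(real (card Z) * real (card W))\<^sup>2 / real (card S) \<le> (\<Sum>y\<in>UNIV. (rep Z W u y)\<^sup>2)"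
proof (cases "S = {}")
  case True
  then show ?thesis by (simp add: sum_nonneg)
next
  case False
  have "(real (card Z) * real (card W))\<^sup>2 = (\<Sum>y\<in>S. rep Z W u y)\<^sup>2"
    unfolding sum_rep[of Z W u, symmetric]
    by (rule arg_cong[where f = "\<lambda>x. x\<^sup>2"], rule sum.mono_neutral_right) (use assms in auto)
  also have "\<dots> \<le> (\<Sum>y\<in>S. (rep Z W u y)\<^sup>2) * real (card S)"
    by (rule sum_squared_le_sum_of_squares)
  also have "(\<Sum>y\<in>S. (rep Z W u y)\<^sup>2) = (\<Sum>y\<in>UNIV. (rep Z W u y)\<^sup>2)"
    by (rule sum.mono_neutral_left) (use assms in auto)
  finally show ?thesis
    using False by (simp add: pos_divide_le_eq card_gt_0_iff)
qed

text \<open>A lower bound for the second moment meets its exact value: slopes in \<open>A\<close>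
  have support in \<open>- A\<close>, of size \<open>q - m\<close>, while for the other nonzero
  slopes Cauchy-Schwarz is applied on the whole field.\<close>

lemma card_power4_le:
  fixes A Z W :: "'a::{field,finite} set"
  assumes A: "0 \<notin> A" "A \<noteq> {}" and card: "card Z = card A" "card W = card A"
    and van: "\<And>u y. u \<in> A \<Longrightarrow> y \<in> A \<Longrightarrow> rep Z W u y = 0"
  shows "real (card A) ^ 4 \<le> (real CARD('a) - real (card A)) ^ 3"
proof -
  define q m where "q = real CARD('a)" and "m = real (card A)"
  have "card A < CARD('a)"
    using A by (intro psubset_card_mono) auto
  then have mq: "0 < m" "m < q"
    using A by (auto simp: m_def q_def card_gt_0_iff)
  have cA: "real (card (- A)) = q - m"
    using \<open>card A < CARD('a)\<close> by (simp add: Compl_eq_Diff_UNIV card_Diff_subset of_nat_diff q_def m_def)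
  have cB: "real (card (UNIV - {0} - A)) = q - 1 - m"
  proof -
    have "UNIV - {0} - A = UNIV - insert 0 A"
      by auto
    then show ?thesis
      using A \<open>card A < CARD('a)\<close>
      by (simp add: card_Diff_subset of_nat_diff q_def m_def)
  qed
  have "m * ((m * m)\<^sup>2 / (q - m)) + (q - 1 - m) * ((m * m)\<^sup>2 / q)
    = (\<Sum>u\<in>A. (m * m)\<^sup>2 / (q - m)) + (\<Sum>u\<in>UNIV - {0} - A. (m * m)\<^sup>2 / q)"
    by (simp add: cB m_def)
  also have "\<dots> \<le> (\<Sum>u\<in>A. \<Sum>y\<in>UNIV. (rep Z W u y)\<^sup>2)
      + (\<Sum>u\<in>UNIV - {0} - A. \<Sum>y\<in>UNIV. (rep Z W u y)\<^sup>2)"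
  proof (intro add_mono sum_mono)
    fix u assume "u \<in> A"
    then show "(m * m)\<^sup>2 / (q - m) \<le> (\<Sum>y\<in>UNIV. (rep Z W u y)\<^sup>2)"
      using second_moment_rep_ge[of "- A" Z W u] van by (simp add: cA card m_def)
  next
    fix u
    show "(m * m)\<^sup>2 / q \<le> (\<Sum>y\<in>UNIV. (rep Z W u y)\<^sup>2)"
      using second_moment_rep_ge[of UNIV Z W u] by (simp add: card m_def q_def)
  qed
  also have "\<dots> = (\<Sum>u\<in>UNIV - {0}. \<Sum>y\<in>UNIV. (rep Z W u y)\<^sup>2)"
    using A by (subst add.commute, intro sum.subset_diff[symmetric]) auto
  also have "\<dots> = (q - 1) * m * m + (m\<^sup>2 - m) * (m\<^sup>2 - m)"
    by (simp add: second_moment_rep card m_def q_def)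
  finally have le: "m * ((m * m)\<^sup>2 / (q - m)) + (q - 1 - m) * ((m * m)\<^sup>2 / q)
      \<le> (q - 1) * m * m + (m\<^sup>2 - m) * (m\<^sup>2 - m)" .
  define n where "n = q - m"
  have q: "q = n + m" and n: "n > 0"
    using mq by (auto simp: n_def)
  \<comment> \<open>Clear the denominators \<open>n\<close> and \<open>q\<close>. After substituting
    \<open>q = n + m\<close>, all terms on the two sides cancel except \<open>m ^ 6\<close> and
    \<open>m\<^sup>2 * n ^ 3\<close>.\<close>
  have "m ^ 5 * q + (q - 1 - m) * m ^ 4 * n
    = (m * ((m * m)\<^sup>2 / n) + (q - 1 - m) * ((m * m)\<^sup>2 / q)) * (q * n)"
    using n mq by (simp add: field_simps power_numeral_reduce)
  also have "\<dots> \<le> ((q - 1) * m * m + (m\<^sup>2 - m) * (m\<^sup>2 - m)) * (q * n)"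
    using le n mq by (intro mult_right_mono) (simp_all add: n_def)
  finally have "m\<^sup>2 * m ^ 4 \<le> m\<^sup>2 * n ^ 3"
    unfolding q by (simp add: algebra_simps power_numeral_reduce)
  then have "m ^ 4 \<le> n ^ 3"
    using mq by (simp only: mult_le_cancel_left_pos zero_less_power)
  then show ?thesis
    by (simp add: n_def m_def q_def)
qed

text \<open>The fibre is the root set of \<open>X^k - a\<close>, a nonzero polynomial of degree
  \<open>k\<close>.\<close>

lemma card_power_fibre_le:
  fixes a :: "'a::idom"
  assumes "k > 0"
  shows "card {x. x ^ k = a} \<le> k"
proof -
  define p where "p = monom 1 k + [:- a:]"
  have "degree p = k"
    unfolding p_def using assms by (subst degree_add_eq_left) (auto simp: degree_monom_eq)
  moreover from this assms have "p \<noteq> 0" by auto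
  moreover have "{x. x ^ k = a} = {x. poly p x = 0}"
    by (auto simp: p_def poly_monom)
  ultimately show ?thesis
    using card_poly_roots_bound[of p] by simp
qed

text \<open>The fibres of \<open>x ^ k\<close> over \<open>A\<close> cover the nonzero elements, and
  each has at most \<open>k\<close> points.\<close>

lemma card_nonzero_le_powers:
  fixes A :: "'a::{field,finite} set"
  assumes "k > 0" and A: "A = (\<lambda>x. x ^ k) ` (UNIV - {0})"
  shows "CARD('a) - 1 \<le> k * card A"
proof -
  have "CARD('a) - 1 = card (UNIV - {0::'a})"
    by (simp add: card_Diff_singleton)
  also have "UNIV - {0::'a} \<subseteq> (\<Union>a\<in>A. {x. x ^ k = a})"
    by (auto simp: A)
  then have "card (UNIV - {0::'a}) \<le> card (\<Union>a\<in>A. {x. x ^ k = a})"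
    by (intro card_mono) auto
  also have "\<dots> \<le> (\<Sum>a\<in>A. card {x. x ^ k = a})"
    by (rule card_UN_le) simp
  also have "\<dots> \<le> (\<Sum>a\<in>A. k)"
    by (intro sum_mono card_power_fibre_le assms)
  finally show ?thesis by (simp add: mult.commute)
qed

lemma nonzero_sum_of_two_powers:
  fixes c :: "'a::{field,finite}"
  assumes k: "k \<ge> 2" and q: "CARD('a) > k ^ 4" and "c \<noteq> 0"
  shows "\<exists>a b. c = a ^ k + b ^ k"
proof (rule ccontr)
  assume neg: "\<nexists>a b. c = a ^ k + b ^ k"
  define A where "A = (\<lambda>x::'a. x ^ k) ` (UNIV - {0})"
  define m where "m = card A"
  have "rep ((*) c ` A) A u y = 0" if "u \<in> A" "y \<in> A" for u y
  proof -
    have "u * z - w \<noteq> y" if z: "z \<in> (*) c ` A" and w: "w \<in> A" for z w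
    proof
      assume eq: "u * z - w = y"
      from \<open>u \<in> A\<close> \<open>y \<in> A\<close> z w obtain s t v x where
        *: "u = s ^ k" "y = v ^ k" "z = c * t ^ k" "w = x ^ k" "s \<noteq> 0" "t \<noteq> 0"
        by (auto simp: A_def)
      from eq * have "c * (s * t) ^ k = x ^ k + v ^ k"
        by (simp add: algebra_simps power_mult_distrib)
      \<comment> \<open>Nonzero \<open>k\<close>-th powers form a group, so the factor
        \<open>(s * t) ^ k\<close> can be divided out inside both powers.\<close>
      then have "c = (x / (s * t)) ^ k + (v / (s * t)) ^ k"
        using * by (simp add: power_divide add_divide_distrib[symmetric] eq_divide_eq)
      with neg show False by blast
    qed
    then show ?thesis by (simp add: rep_def)
  qed
  moreover have "card ((*) c ` A) = card A"
    using \<open>c \<noteq> 0\<close> by (intro card_image inj_onI) simp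
  moreover have "0 \<notin> A" "A \<noteq> {}"
    using one_neq_zero[where 'a = 'a] by (auto simp: A_def simp del: one_neq_zero)
  ultimately have le: "real m ^ 4 \<le> (real CARD('a) - real m) ^ 3"
    unfolding m_def by (intro card_power4_le[where Z = "(*) c ` A" and W = A]) simp_all
  have qm: "CARD('a) \<le> k * m + 1"
    using card_nonzero_le_powers[OF _ A_def] k by (simp add: m_def)
  \<comment> \<open>The strict bound \<open>k ^ 4 < q\<close> absorbs the \<open>+ 1\<close> in
    \<open>qm\<close>.\<close>
  with q have "k * k ^ 3 \<le> k * m"
    by (simp flip: power_Suc)
  then have km: "k ^ 3 \<le> m"
    using k by simp
  have "2 ^ 3 \<le> k ^ 3"
    using k by (rule power_mono) simp
  with km have "m > 1" by simp
  have "m \<le> CARD('a)"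
    unfolding m_def by (rule card_mono) auto
  moreover have "real CARD('a) \<le> real (k * m) + 1"
    using qm by linarith
  \<comment> \<open>Here \<open>q - m \<le> k * m + 1 - m < k * m\<close> because
    \<open>m > 1\<close>, and \<open>m \<le> q\<close> keeps the smaller base nonnegative.\<close>
  ultimately have "(real CARD('a) - real m) ^ 3 < (real (k * m)) ^ 3"
    using \<open>m > 1\<close> by (intro power_strict_mono) linarith+
  also have "\<dots> = real (k ^ 3) * real m ^ 3"
    by (simp add: power_mult_distrib)
  also have "\<dots> \<le> real m * real m ^ 3"
    using km by (intro mult_right_mono) (simp_all del: of_nat_power)
  also have "\<dots> = real m ^ 4"
    by (simp add: power_numeral_reduce)
  finally show False using le by simp
qed

theorem theorem3p2:
  fixes k :: nat
  assumes "k > 0"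
    and "CARD('a :: {field, finite}) > k ^ 4"
  shows "\<forall>x :: 'a. \<exists>a b :: 'a. x = a ^ k + b ^ k"
proof
  fix x :: 'a
  \<comment> \<open>For \<open>k = 1\<close> take \<open>x + 0\<close>; for \<open>x = 0\<close>
    take \<open>0 ^ k + 0 ^ k\<close>, where \<open>k > 0\<close> makes
    \<open>0 ^ k = 0\<close>.\<close>
  consider "k = 1" | "x = 0" | "k \<ge> 2" "x \<noteq> 0"
    using assms(1) by linarith
  then show "\<exists>a b :: 'a. x = a ^ k + b ^ k"
  proof cases
    case 1
    then show ?thesis by (intro exI[of _ x] exI[of _ 0]) simp
  next
    case 2
    then show ?thesis using assms(1) by (intro exI[of _ 0]) simp
  next
    case 3
    then show ?thesis using nonzero_sum_of_two_powers assms(2) by blast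
  qed
qed

end
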